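(* Let $T$ be a reduced set of permutations, each of length at least $2$. The map $s_T$ is bijective (as a map $S_n\to S_n$ for every $n\ge 1$) if and only if for every $\sigma\in T$ we also have $\hat{\sigma}\in T$. In this case, the map $r\circ s_T\circ r$ is the inverse of $s_T$, where $r$ is the reverse operation $r(\pi(1)\pi(2)\cdots\pi(n))=\pi(n)\cdots\pi(2)\pi(1)$.
   Context: A sequence $w$ of distinct integers contains a permutation $\tau$ of length $m$ if some (not necessarily contiguous) subsequence of $w$ of length $m$ is order-isomorphic to $\tau$ (i.e. its entries are in the same relative order as those of $\tau$); otherwise $w$ avoids $\tau$. It avoids a set $T$ if it avoids every element of $T$. A set $T$ of permutations is reduced if there are no two distinct $\sigma,\tau\in T$ with $\sigma$ containing $\tau$. For a permutation $\sigma$ of length $k\ge 2$, $\hat{\sigma}=\sigma(2)\sigma(1)\sigma(3)\cdots\sigma(k)$. For a set $T$ of permutations (each of length at least $2$), the map $s_T$ sends a permutation $\pi=\pi(1)\cdots\pi(n)$ to the output of the following procedure: start with an empty stack and empty output, reading $\pi$ from left to right as input; at each step, if there is a next input element and pushing it onto the stack keeps the stack contents, read from top to bottom, $T$-avoiding, push it; otherwise pop the top element of the stack and append it to the output; stop when the input and stack are both empty. *)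

theory Defs
  imports "HOL-Library.Sublist" "HOL-Combinatorics.Multiset_Permutations"
begin

text \<open>Permutations of length \<open>n\<close> are written in one-line notation as lists.\<close>

definition perms :: "nat \<Rightarrow> nat list set" where
  "perms n = permutations_of_set {1..n}"

definition order_isomorphic :: "nat list \<Rightarrow> nat list \<Rightarrow> bool" where
  "order_isomorphic u v \<longleftrightarrow> length u = length v \<and>
     (\<forall>i < length u. \<forall>j < length u. u ! i < u ! j \<longleftrightarrow> v ! i < v ! j)"

definition contains :: "nat list \<Rightarrow> nat list \<Rightarrow> bool" where
  "contains w \<tau> \<longleftrightarrow> (\<exists>u. subseq u w \<and> order_isomorphic u \<tau>)"

definition avoids :: "nat list \<Rightarrow> nat list set \<Rightarrow> bool" where
  "avoids w T \<longleftrightarrow> (\<forall>\<tau>\<in>T. \<not> contains w \<tau>)"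

definition reduced :: "nat list set \<Rightarrow> bool" where
  "reduced T \<longleftrightarrow> \<not> (\<exists>\<sigma>\<in>T. \<exists>\<tau>\<in>T. \<sigma> \<noteq> \<tau> \<and> contains \<sigma> \<tau>)"

text \<open>Only meant for lists of length at least 2.\<close>

fun hat :: "nat list \<Rightarrow> nat list" where
  "hat (a # b # xs) = b # a # xs"
| "hat xs = xs"

text \<open>
  \<open>stack_run T stack input\<close> is the output still to be produced from the given stack (whose
  head is its top) and remaining input. The \<open>else\<close> branch for the empty stack, where the
  procedure would be stuck, is never reached if all elements of \<open>T\<close> have length at least 2.
\<close>

fun stack_run :: "nat list set \<Rightarrow> nat list \<Rightarrow> nat list \<Rightarrow> nat list" where
  "stack_run T [] [] = []"
| "stack_run T (y # st) [] = y # stack_run T st []"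
| "stack_run T [] (x # xs) = (if avoids [x] T then stack_run T [x] xs else [])"
| "stack_run T (y # st) (x # xs) =
     (if avoids (x # y # st) T then stack_run T (x # y # st) xs
      else y # stack_run T st (x # xs))"

definition stack_map :: "nat list set \<Rightarrow> nat list \<Rightarrow> nat list" where
  "stack_map T \<pi> = stack_run T [] \<pi>"

end

theory Submission
  imports Defs
begin

text \<open>
  Let \<open>T\<close> be closed under \<open>hat\<close>. Run backwards in time, the procedure turns pushes into pops and
  vice versa, and the claim is that this reversed history is again the greedy history on the
  reversed output. If \<open>z\<close> is popped because the input letter \<open>x\<close> cannot be pushed, then a
  forbidden pattern of \<open>x z st\<close> uses both \<open>x\<close> and \<open>z\<close>, so \<open>z x st\<close> contains the hat of this
  pattern; hence the reversed machine has to pop \<open>x\<close> before it can push \<open>z\<close>.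

  Conversely, choose \<open>\<sigma> \<in> T\<close> with \<open>hat \<sigma> \<notin> T\<close> of minimal length. Minimality and reducedness
  force \<open>hat \<sigma>\<close> to avoid \<open>T\<close>, and then the reverses of \<open>\<sigma>\<close> and of \<open>hat \<sigma>\<close> are both sent
  to \<open>hat \<sigma>\<close>.
\<close>

section \<open>Order isomorphism and pattern containment\<close>

lemma order_isomorphic_length: "order_isomorphic u v \<Longrightarrow> length u = length v"
  by (simp add: order_isomorphic_def)

lemma order_isomorphic_hat:
  assumes "order_isomorphic (a # b # u) \<tau>"
  shows "order_isomorphic (b # a # u) (hat \<tau>)"
proof -
  obtain c d v where \<tau>: "\<tau> = c # d # v"
    using order_isomorphic_length[OF assms] by (metis length_Suc_conv)
  show ?thesis
    using assms unfolding \<tau> by (auto simp: order_isomorphic_def All_less_Suc2)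
qed

lemma perms_iff: "u \<in> perms n \<longleftrightarrow> set u = {1..n} \<and> distinct u"
  by (auto simp: perms_def permutations_of_set_def)

lemma perms_length: "u \<in> perms n \<Longrightarrow> length u = n"
  using distinct_card[of u] by (simp add: perms_iff)

lemma rev_in_perms [simp]: "rev u \<in> perms n \<longleftrightarrow> u \<in> perms n"
  by (simp add: perms_iff)

lemma hat_in_perms [simp]: "hat u \<in> perms n \<longleftrightarrow> u \<in> perms n"
  by (cases u rule: hat.cases) (auto simp: perms_iff)

text \<open>Recovers each entry from comparisons alone, which \<open>order_isomorphic\<close>
  preserves; hence order-isomorphic permutations coincide.\<close>

lemma perms_nth_eq_card:
  assumes "u \<in> perms n" "i < n"
  shows "u ! i = Suc (card {j. j < n \<and> u ! j < u ! i})"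
proof -
  have u: "set u = {1..n}" "distinct u" "length u = n"
    using assms perms_length by (auto simp: perms_iff)
  have "u ! i \<in> {1..n}"
    using u assms(2) nth_mem by metis
  have "nth u ` {j. j < n \<and> u ! j < u ! i} = {x \<in> set u. x < u ! i}"
    using u(3) by (auto simp: in_set_conv_nth)
  also have "\<dots> = {1..<u ! i}"
    using u(1) \<open>u ! i \<in> {1..n}\<close> by auto
  finally have "card (nth u ` {j. j < n \<and> u ! j < u ! i}) = u ! i - 1"
    by simp
  moreover have "inj_on (nth u) {j. j < n \<and> u ! j < u ! i}"
    using u by (auto simp: inj_on_def nth_eq_iff_index_eq)
  ultimately show ?thesis
    using \<open>u ! i \<in> {1..n}\<close> by (simp add: card_image)
qed

lemma order_isomorphic_perms_eq:
  assumes "order_isomorphic u v" "u \<in> perms n" "v \<in> perms m"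
  shows "u = v"
proof (rule nth_equalityI)
  show "length u = length v"
    using assms(1) by (rule order_isomorphic_length)
  fix i assume "i < length u"
  have "length u = n" "length v = n" "m = n"
    using assms perms_length order_isomorphic_length by metis+
  then have "{j. j < n \<and> u ! j < u ! i} = {j. j < n \<and> v ! j < v ! i}"
    using assms(1) \<open>i < length u\<close> by (auto simp: order_isomorphic_def)
  then show "u ! i = v ! i"
    using perms_nth_eq_card assms \<open>i < length u\<close> \<open>length u = n\<close> \<open>m = n\<close> by metis
qed

lemma contains_length: "contains w \<tau> \<Longrightarrow> length \<tau> \<le> length w"
  by (metis contains_def order_isomorphic_length list_emb_length)

lemma contains_subseq: "contains v \<tau> \<Longrightarrow> subseq v w \<Longrightarrow> contains w \<tau>"
  unfolding contains_def using subseq_order.trans by blast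

lemma avoids_subseq: "avoids w T \<Longrightarrow> subseq v w \<Longrightarrow> avoids v T"
  unfolding avoids_def using contains_subseq by blast

text \<open>An occurrence that uses both \<open>a\<close> and \<open>b\<close> has them as its first
  two letters, so exchanging them turns it into an occurrence of \<open>hat \<tau>\<close>.\<close>

lemma contains_Cons_Cons_cases:
  assumes "contains (a # b # w) \<tau>"
  obtains "contains (a # w) \<tau>" | "contains (b # w) \<tau>" | "contains (b # a # w) (hat \<tau>)"
proof -
  obtain u where u: "subseq u (a # b # w)" "order_isomorphic u \<tau>"
    using assms by (auto simp: contains_def)
  consider "subseq u (a # w)" | "subseq u (b # w)" | u' where "u = a # b # u'" "subseq u' w"
    using u(1) by (cases u; cases "tl u") (auto split: if_splits)
  then show thesis
  proof cases
    case 3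
    then have "subseq (b # a # u') (b # a # w)"
      by simp
    then show ?thesis
      using that(3) order_isomorphic_hat u(2) 3(1) unfolding contains_def by blast
  qed (use that u(2) in \<open>auto simp: contains_def\<close>)
qed

lemma not_avoids_swap:
  assumes "\<And>\<sigma>. \<sigma> \<in> T \<Longrightarrow> hat \<sigma> \<in> T"
    and "\<not> avoids (x # z # st) T" "avoids (x # st) T" "avoids (z # st) T"
  shows "\<not> avoids (z # x # st) T"
  using assms contains_Cons_Cons_cases unfolding avoids_def by metis

lemma avoids_short:
  assumes "\<And>\<sigma>. \<sigma> \<in> T \<Longrightarrow> length \<sigma> \<ge> 2" "length w < 2"
  shows "avoids w T"
  unfolding avoids_def using assms contains_length by (meson leD le_less_trans)

section \<open>Reversing the run of the machine\<close>

lemma mset_stack_run: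
  assumes "\<And>\<sigma>. \<sigma> \<in> T \<Longrightarrow> length \<sigma> \<ge> 2"
  shows "mset (stack_run T st xs) = mset st + mset xs"
  using assms by (induction T st xs rule: stack_run.induct) (auto simp: avoids_short)

lemma stack_map_in_perms:
  assumes "\<And>\<sigma>. \<sigma> \<in> T \<Longrightarrow> length \<sigma> \<ge> 2" "\<pi> \<in> perms n"
  shows "stack_map T \<pi> \<in> perms n"
proof -
  have "mset (stack_map T \<pi>) = mset \<pi>"
    unfolding stack_map_def using assms(1) by (simp add: mset_stack_run)
  then show ?thesis
    using assms(2) by (metis perms_iff mset_eq_setD mset_eq_imp_distinct_iff)
qed

text \<open>
  In a state of the machine, \<open>zs\<close> is the output so far, most recent letter first, that is, the
  remaining input of the reversed machine. The last assumption is an invariant: either the last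
  step was a pop, of the letter \<open>z\<close>, or the reversed machine cannot push \<open>z\<close>.
\<close>

lemma stack_run_rev_stack_run:
  assumes "\<And>\<sigma>. \<sigma> \<in> T \<Longrightarrow> hat \<sigma> \<in> T"
    and "\<And>\<sigma>. \<sigma> \<in> T \<Longrightarrow> length \<sigma> \<ge> 2"
    and "avoids st T"
    and "\<And>z zs'. zs = z # zs' \<Longrightarrow> avoids (z # st) T \<Longrightarrow>
           xs = [] \<or> \<not> avoids (hd xs # z # st) T"
  shows "stack_run T [] (rev (stack_run T st xs) @ zs) = rev xs @ stack_run T st zs"
  using assms
proof (induction T st xs arbitrary: zs rule: stack_run.induct)
  case (1 T)
  then show ?case by simp
next
  case (2 T y st)
  have "avoids st T"
    using avoids_subseq[OF 2(4)] by auto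
  have "stack_run T [] (rev (stack_run T st []) @ (y # zs)) = rev [] @ stack_run T st (y # zs)"
    by (rule "2.IH") (use 2 \<open>avoids st T\<close> in auto)
  \<comment> \<open>As \<open>y # st\<close> avoids \<open>T\<close>, the reversed machine starts by
    pushing \<open>y\<close>, which mirrors the pop.\<close>
  moreover have "stack_run T st (y # zs) = stack_run T (y # st) zs"
    using 2(4) by (cases st) auto
  ultimately show ?case by simp
next
  case (3 T x xs)
  have av: "avoids [x] T"
    using 3(3) by (simp add: avoids_short)
  have z: "\<not> avoids (z # [x]) T" if "zs = z # zs'" for z zs'
    using not_avoids_swap[OF 3(2), of x z "[]"] 3(5)[OF that] avoids_short[OF 3(3)] by simp
  have "stack_run T [] (rev (stack_run T [x] xs) @ zs) = rev xs @ stack_run T [x] zs"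
    by (rule "3.IH") (use 3 av z in auto)
  \<comment> \<open>Whether \<open>zs\<close> is empty or its first letter is blocked, the reversed
    machine pops \<open>x\<close> at once, which mirrors the push.\<close>
  moreover have "stack_run T [x] zs = x # stack_run T [] zs"
    using z by (cases zs) auto
  ultimately show ?case using av by simp
next
  case (4 T y st x xs)
  show ?case
  proof (cases "avoids (x # y # st) T")
    case True
    \<comment> \<open>If \<open>z\<close> fits on \<open>y # st\<close>, the invariant keeps
      \<open>x\<close> off \<open>z # y # st\<close>, and swapping keeps \<open>z\<close> off
      \<open>x # y # st\<close>.\<close>
    have z: "\<not> avoids (z # x # y # st) T" if "zs = z # zs'" for z zs'
    proof (cases "avoids (z # y # st) T")
      case av: True
      then show ?thesis
        using not_avoids_swap[OF 4(3), of x z "y # st"] 4(6)[OF that av] True by simp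
    next
      case False
      have "subseq (z # y # st) (z # x # y # st)" by auto
      then show ?thesis
        using False avoids_subseq by blast
    qed
    have "stack_run T [] (rev (stack_run T (x # y # st) xs) @ zs)
        = rev xs @ stack_run T (x # y # st) zs"
      by (rule "4.IH"(1)) (use 4 True z in auto)
    moreover have "stack_run T (x # y # st) zs = x # stack_run T (y # st) zs"
      using z by (cases zs) auto
    ultimately show ?thesis using True by simp
  next
    case False
    have "avoids st T"
      using avoids_subseq[OF 4(5)] by auto
    \<comment> \<open>The failed push of \<open>x\<close> onto \<open>y # st\<close> is precisely
      the invariant for the popped letter \<open>y\<close>.\<close>
    have "stack_run T [] (rev (stack_run T st (x # xs)) @ (y # zs))
        = rev (x # xs) @ stack_run T st (y # zs)"
      by (rule "4.IH"(2)) (use 4 False \<open>avoids st T\<close> in auto)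
    moreover have "stack_run T st (y # zs) = stack_run T (y # st) zs"
      using 4(5) by (cases st) auto
    ultimately show ?thesis using False by simp
  qed
qed

lemma stack_map_rev_stack_map:
  assumes "\<And>\<sigma>. \<sigma> \<in> T \<Longrightarrow> hat \<sigma> \<in> T" "\<And>\<sigma>. \<sigma> \<in> T \<Longrightarrow> length \<sigma> \<ge> 2"
  shows "stack_map T (rev (stack_map T \<pi>)) = rev \<pi>"
  unfolding stack_map_def
  using stack_run_rev_stack_run[of T "[]" "[]" \<pi>] assms by (simp add: avoids_short)

lemma bij_betw_stack_map:
  assumes "\<And>\<sigma>. \<sigma> \<in> T \<Longrightarrow> hat \<sigma> \<in> T" "\<And>\<sigma>. \<sigma> \<in> T \<Longrightarrow> length \<sigma> \<ge> 2"
  shows "bij_betw (stack_map T) (perms n) (perms n)"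
proof (rule bij_betw_byWitness[where f' = "rev \<circ> stack_map T \<circ> rev"])
  show "stack_map T ` perms n \<subseteq> perms n"
    using stack_map_in_perms assms(2) by blast
  show "(rev \<circ> stack_map T \<circ> rev) ` perms n \<subseteq> perms n"
    using stack_map_in_perms[OF assms(2)] by auto
\<comment> \<open>One identity gives both compositions: apply \<open>rev\<close> to both sides, or
  substitute \<open>rev \<pi>\<close> for \<open>\<pi>\<close>.\<close>
qed (use stack_map_rev_stack_map[OF assms] in auto)

section \<open>Failure of injectivity without closure under \<open>hat\<close>\<close>

lemma stack_run_Nil [simp]: "stack_run T st [] = st"
  by (induction st) auto

text \<open>Every intermediate stack is a suffix of the final one and so avoids \<open>T\<close>; no
  pop is forced.\<close>

lemma stack_run_push_all:
  assumes "avoids (rev xs @ st) T"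
  shows "stack_run T st (xs @ ys) = stack_run T (rev xs @ st) ys"
  using assms
proof (induction xs arbitrary: st)
  case (Cons x xs)
  have "avoids (x # st) T"
    using avoids_subseq[OF Cons.prems, of "x # st"] list_emb_append2[of "(=)" "x # st"] by simp
  then have "stack_run T st ((x # xs) @ ys) = stack_run T (x # st) (xs @ ys)"
    by (cases st) auto
  then show ?case
    using Cons by simp
qed simp

lemma reduced_avoids_proper_subseq:
  assumes "reduced T" "\<sigma> \<in> T" "subseq w \<sigma>" "length w < length \<sigma>"
  shows "avoids w T"
  using assms contains_length contains_subseq unfolding avoids_def reduced_def
  by (metis leD)

text \<open>An occurrence of \<open>\<tau>\<close> that misses \<open>a\<close> or \<open>b\<close>
  already lies in \<open>a # b # w\<close>. One that uses both yields \<open>hat \<tau>\<close>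
  inside \<open>a # b # w\<close>, where \<open>hat \<tau>\<close> is in \<open>T\<close> by
  minimality once \<open>\<tau>\<close> is shorter. Either way reducedness is violated.\<close>

lemma reduced_minimal_hat_avoids:
  assumes perm: "\<And>\<sigma>. \<sigma> \<in> T \<Longrightarrow> \<sigma> \<in> perms (length \<sigma>)"
    and red: "reduced T"
    and \<sigma>: "a # b # w \<in> T" "b # a # w \<notin> T"
    and min: "\<And>\<tau>. \<tau> \<in> T \<Longrightarrow> length \<tau> < length (a # b # w) \<Longrightarrow> hat \<tau> \<in> T"
  shows "avoids (b # a # w) T"
proof -
  have False if \<tau>: "\<tau> \<in> T" "contains (b # a # w) \<tau>" for \<tau>
    using \<tau>(2)
  proof (cases rule: contains_Cons_Cons_cases)
    case 1
    have "subseq (b # w) (a # b # w)"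
      by (rule list_emb_Cons) simp
    then show False
      using 1 reduced_avoids_proper_subseq[OF red \<sigma>(1), of "b # w"] \<tau>(1)
      by (auto simp: avoids_def simp del: subseq_Cons2_iff)
  next
    case 2
    then show False
      using reduced_avoids_proper_subseq[OF red \<sigma>(1), of "a # w"] \<tau>(1)
      by (auto simp: avoids_def)
  next
    case 3
    have len_hat: "length (hat \<tau>) = length \<tau>"
      by (cases \<tau> rule: hat.cases) auto
    obtain u where u: "subseq u (b # a # w)" "order_isomorphic u \<tau>"
      using \<tau>(2) by (auto simp: contains_def)
    \<comment> \<open>An occurrence of full length would make \<open>\<tau>\<close> equal to
      \<open>b # a # w\<close>, which is not in \<open>T\<close>.\<close>
    have "u \<noteq> b # a # w"
    proof
      assume "u = b # a # w"
      moreover have "b # a # w \<in> perms (length (a # b # w))"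
        using perm[OF \<sigma>(1)] hat_in_perms[of "a # b # w"] by simp
      ultimately have "b # a # w = \<tau>"
        using order_isomorphic_perms_eq u(2) perm[OF \<tau>(1)] by blast
      then show False using \<sigma>(2) \<tau>(1) by simp
    qed
    then have less: "length \<tau> < length (a # b # w)"
      using u order_isomorphic_length[OF u(2)] list_emb_length[OF u(1)]
        subseq_same_length[OF u(1)] by (cases "length u = length (b # a # w)") auto
    then have "hat \<tau> \<in> T" "hat \<tau> \<noteq> a # b # w"
      using min \<tau>(1) len_hat by auto
    then show False
      using red \<sigma>(1) 3 unfolding reduced_def by metis
  qed
  then show ?thesis by (auto simp: avoids_def)
qed

lemma bij_betw_stack_map_imp_hat_closed:
  assumes perm: "\<And>\<sigma>. \<sigma> \<in> T \<Longrightarrow> \<sigma> \<in> perms (length \<sigma>)"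
    and len: "\<And>\<sigma>. \<sigma> \<in> T \<Longrightarrow> length \<sigma> \<ge> 2"
    and red: "reduced T"
    and bij: "\<And>n. n \<ge> 1 \<Longrightarrow> bij_betw (stack_map T) (perms n) (perms n)"
    and "\<sigma> \<in> T"
  shows "hat \<sigma> \<in> T"
  using \<open>\<sigma> \<in> T\<close>
proof (induction \<sigma> rule: length_induct)
  case (1 \<sigma>)
  obtain a b w where \<sigma>: "\<sigma> = a # b # w"
    using len[OF 1(2)] by (cases \<sigma> rule: hat.cases) auto
  show ?case
  proof (rule ccontr)
    assume "hat \<sigma> \<notin> T"
    then have hat: "avoids (b # a # w) T"
      using reduced_minimal_hat_avoids[OF perm red, of a b w] 1 \<sigma> by auto
    have "avoids (b # w) T" "avoids (a # w) T"
      using avoids_subseq[OF hat] by auto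
    have "\<not> avoids (a # b # w) T"
      using 1(2) \<sigma> by (auto simp: avoids_def contains_def order_isomorphic_def)
    have "stack_map T (rev (b # a # w)) = b # a # w"
      using stack_run_push_all[of "rev (b # a # w)" "[]" T "[]"] hat
      by (simp add: stack_map_def)
    \<comment> \<open>With \<open>b # w\<close> stacked, \<open>a\<close> is blocked;
      \<open>b\<close> leaves first, then \<open>a\<close> fits on \<open>w\<close>, and the stack
      \<open>a # w\<close> is emptied.\<close>
    moreover have "stack_map T (rev (a # b # w)) = b # a # w"
    proof -
      have "stack_map T (rev (a # b # w)) = stack_run T (b # w) [a]"
        using stack_run_push_all[of "rev (b # w)" "[]" T "[a]"] \<open>avoids (b # w) T\<close>
        by (simp add: stack_map_def)
      also have "\<dots> = b # stack_run T w [a]"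
        using \<open>\<not> avoids (a # b # w) T\<close> by simp
      also have "stack_run T w [a] = a # w"
        using \<open>avoids (a # w) T\<close> by (cases w) auto
      finally show ?thesis .
    qed
    moreover have "inj_on (stack_map T) (perms (length \<sigma>))"
      using bij[of "length \<sigma>"] \<sigma> by (auto simp: bij_betw_def)
    moreover have "a # b # w \<in> perms (length \<sigma>)" "b # a # w \<in> perms (length \<sigma>)"
      using perm[OF 1(2)] hat_in_perms[of \<sigma> "length \<sigma>"] \<sigma> by auto
    ultimately have "rev (a # b # w) = rev (b # a # w)"
      by (metis inj_onD rev_in_perms)
    then have "a = b"
      by (metis list.inject rev_is_rev_conv)
    then show False
      using perm[OF 1(2)] \<sigma> by (simp add: perms_iff)
  qed
qed

theorem theorem1p1:
  fixes T :: "nat list set"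
  assumes perm: "\<And>\<sigma>. \<sigma> \<in> T \<Longrightarrow> \<sigma> \<in> perms (length \<sigma>)"
    and len: "\<And>\<sigma>. \<sigma> \<in> T \<Longrightarrow> length \<sigma> \<ge> 2"
    and red: "reduced T"
  shows "((\<forall>n\<ge>1. bij_betw (stack_map T) (perms n) (perms n)) \<longleftrightarrow> (\<forall>\<sigma>\<in>T. hat \<sigma> \<in> T)) \<and>
         ((\<forall>n\<ge>1. bij_betw (stack_map T) (perms n) (perms n)) \<longrightarrow>
           (\<forall>n\<ge>1. \<forall>\<pi>\<in>perms n.
              (rev \<circ> stack_map T \<circ> rev) (stack_map T \<pi>) = \<pi> \<and>
              stack_map T ((rev \<circ> stack_map T \<circ> rev) \<pi>) = \<pi>))"
proof -
  have iff: "(\<forall>n\<ge>1. bij_betw (stack_map T) (perms n) (perms n)) \<longleftrightarrow> (\<forall>\<sigma>\<in>T. hat \<sigma> \<in> T)"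
    using bij_betw_stack_map_imp_hat_closed[OF perm len red] bij_betw_stack_map[OF _ len]
    by blast
  have "(rev \<circ> stack_map T \<circ> rev) (stack_map T \<pi>) = \<pi>"
    "stack_map T ((rev \<circ> stack_map T \<circ> rev) \<pi>) = \<pi>"
    if "\<forall>\<sigma>\<in>T. hat \<sigma> \<in> T" for \<pi>
    using that stack_map_rev_stack_map[OF _ len] by auto
  then show ?thesis
    using iff by blast
qed

end
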